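(* Let $\mathbf{k}$ be a commutative ring with unit. For every $n\ge 0$, the right comb tree $F_n^{r}$ and the left comb tree $F_n^{\ell}$ with $n$ internal vertices satisfy $$\Delta_{\rm LR}^{\epsilon}(F_n^{r})=\sum_{i=0}^{n-1}F_{n-1-i}^{r}\otimes F_i^{r},\qquad \Delta_{\rm LR}^{\epsilon}(F_n^{\ell})=\sum_{i=0}^{n-1}F_i^{\ell}\otimes F_{n-1-i}^{\ell},$$ where each sum is understood to be zero for $n=0$.
   Context: All modules, tensor products and linear maps are over $\mathbf{k}$. Planar binary trees: a planar binary tree is a finite rooted planar tree in which every internal vertex has exactly two ordered incoming branches (left and right). The trivial tree, with no internal vertices, is denoted $|$. Let $\mathcal{Y}$ be the set of planar binary trees and $H_{\rm LR}^{\epsilon}:=\mathbf{k}\mathcal{Y}$ the free $\mathbf{k}$-module on it. Grafting: for $T_l,T_r\in\mathcal{Y}$, $T_l\vee T_r$ is the tree obtained by creating a new root with left branch $T_l$ and right branch $T_r$; $\vee$ is extended bilinearly. Every $T\in\mathcal{Y}$ with $T\neq |$ is uniquely of the form $T=T_l\vee T_r$. Comb trees: $F_0^{r}:=|$ and $F_n^{r}:=F_{n-1}^{r}\vee|$ for $n\ge1$ (right combs); $F_0^{\ell}:=|$ and $F_n^{\ell}:=|\vee F_{n-1}^{\ell}$ for $n\ge1$ (left combs). Infinitesimal coproduct: the linear map $\Delta_{\rm LR}^{\epsilon}:H_{\rm LR}^{\epsilon}\to H_{\rm LR}^{\epsilon}\otimes H_{\rm LR}^{\epsilon}$ defined on trees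 recursively by $\Delta_{\rm LR}^{\epsilon}(|)=0$ and $$\Delta_{\rm LR}^{\epsilon}(T_l\vee T_r)=T_l\otimes T_r+(\mathrm{id}\otimes\vee)(\Delta_{\rm LR}^{\epsilon}(T_l)\otimes T_r)+(\vee\otimes\mathrm{id})(T_l\otimes\Delta_{\rm LR}^{\epsilon}(T_r)).$$ *)

theory Defs
  imports Complex_Main "HOL-Library.Poly_Mapping"
begin

section \<open>Free modules and their tensor products\<close>

text \<open>
  The sort \<open>{comm_ring, comm_monoid_mult}\<close> is exactly the class of commutative unital rings;
  unlike \<open>comm_ring_1\<close> (which is contained in it) it does not exclude the zero ring.
  The free module on the basis \<open>'b\<close> is the type \<open>'b \<Rightarrow>\<^sub>0 'k\<close> of finitely supported functions.
\<close>

definition smult :: "'k::{comm_ring,comm_monoid_mult} \<Rightarrow> ('b \<Rightarrow>\<^sub>0 'k) \<Rightarrow> ('b \<Rightarrow>\<^sub>0 'k)"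
  where "smult c x = Poly_Mapping.map ((*) c) x"

definition basis :: "'b \<Rightarrow> ('b \<Rightarrow>\<^sub>0 'k::{comm_ring,comm_monoid_mult})"
  where "basis b = Poly_Mapping.single b 1"

text \<open>The linear extension of \<open>f\<close>, where \<open>s\<close> is the scalar multiplication of the codomain.\<close>

definition lin_ext ::
    "('k::{comm_ring,comm_monoid_mult} \<Rightarrow> 'm::ab_group_add \<Rightarrow> 'm) \<Rightarrow> ('b \<Rightarrow> 'm) \<Rightarrow> ('b \<Rightarrow>\<^sub>0 'k) \<Rightarrow> 'm"
  where "lin_ext s f x = (\<Sum>b\<in>Poly_Mapping.keys x. s (Poly_Mapping.lookup x b) (f b))"

text \<open>
  The tensor product of the free modules on \<open>'b\<close> and \<open>'c\<close> is realised as the free module on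
  \<open>'b \<times> 'c\<close>; the universal property is lemma \<open>tensor_universal\<close> below.
\<close>

definition tensor ::
    "('b \<Rightarrow>\<^sub>0 'k) \<Rightarrow> ('c \<Rightarrow>\<^sub>0 'k) \<Rightarrow> ('b \<times> 'c \<Rightarrow>\<^sub>0 'k::{comm_ring,comm_monoid_mult})"  (infixl \<open>\<otimes>\<close> 70)
  where "x \<otimes> y = (\<Sum>b\<in>Poly_Mapping.keys x. \<Sum>c\<in>Poly_Mapping.keys y.
           Poly_Mapping.single (b, c) (Poly_Mapping.lookup x b * Poly_Mapping.lookup y c))"

text \<open>The tensor product of two maps; meaningful if both are linear, see \<open>tensor_map_tensor\<close>.\<close>

definition tensor_map ::
    "(('b \<Rightarrow>\<^sub>0 'k) \<Rightarrow> ('d \<Rightarrow>\<^sub>0 'k)) \<Rightarrow> (('c \<Rightarrow>\<^sub>0 'k) \<Rightarrow> ('e \<Rightarrow>\<^sub>0 'k))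
      \<Rightarrow> ('b \<times> 'c \<Rightarrow>\<^sub>0 'k::{comm_ring,comm_monoid_mult}) \<Rightarrow> ('d \<times> 'e \<Rightarrow>\<^sub>0 'k)"
  where "tensor_map f g = lin_ext smult (\<lambda>(b, c). f (basis b) \<otimes> g (basis c))"

definition assoc_r ::
    "(('a \<times> 'b) \<times> 'c \<Rightarrow>\<^sub>0 'k::{comm_ring,comm_monoid_mult}) \<Rightarrow> ('a \<times> ('b \<times> 'c) \<Rightarrow>\<^sub>0 'k)"
  where "assoc_r = lin_ext smult (\<lambda>((a, b), c). basis a \<otimes> (basis b \<otimes> basis c))"

definition assoc_l ::
    "('a \<times> ('b \<times> 'c) \<Rightarrow>\<^sub>0 'k::{comm_ring,comm_monoid_mult}) \<Rightarrow> (('a \<times> 'b) \<times> 'c \<Rightarrow>\<^sub>0 'k)"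
  where "assoc_l = lin_ext smult (\<lambda>(a, (b, c)). (basis a \<otimes> basis b) \<otimes> basis c)"


section \<open>Planar binary trees and the infinitesimal coproduct\<close>

datatype pbtree = Triv | Graft pbtree pbtree

primrec internal_vertices :: "pbtree \<Rightarrow> nat" where
  "internal_vertices Triv = 0"
| "internal_vertices (Graft l r) = internal_vertices l + internal_vertices r + 1"

primrec right_comb :: "nat \<Rightarrow> pbtree" where
  "right_comb 0 = Triv"
| "right_comb (Suc n) = Graft (right_comb n) Triv"

primrec left_comb :: "nat \<Rightarrow> pbtree" where
  "left_comb 0 = Triv"
| "left_comb (Suc n) = Graft Triv (left_comb n)"

text \<open>The bilinear extension of grafting, as a linear map on the tensor square.\<close>

definition graft :: "(pbtree \<times> pbtree \<Rightarrow>\<^sub>0 'k::{comm_ring,comm_monoid_mult}) \<Rightarrow> (pbtree \<Rightarrow>\<^sub>0 'k)"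
  where "graft = lin_ext smult (\<lambda>(l, r). basis (Graft l r))"

text \<open>
  The recursion for the infinitesimal coproduct usually identifies the two bracketings of a triple
  tensor product; \<open>assoc_r\<close> and \<open>assoc_l\<close> make this identification explicit.
\<close>

primrec coproduct_tree :: "pbtree \<Rightarrow> (pbtree \<times> pbtree \<Rightarrow>\<^sub>0 'k::{comm_ring,comm_monoid_mult})" where
  "coproduct_tree Triv = 0"
| "coproduct_tree (Graft l r) =
     basis l \<otimes> basis r
     + tensor_map id graft (assoc_r (coproduct_tree l \<otimes> basis r))
     + tensor_map graft id (assoc_l (basis l \<otimes> coproduct_tree r))"

definition coproduct ::
    "(pbtree \<Rightarrow>\<^sub>0 'k::{comm_ring,comm_monoid_mult}) \<Rightarrow> (pbtree \<times> pbtree \<Rightarrow>\<^sub>0 'k)"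
  where "coproduct = lin_ext smult coproduct_tree"


section \<open>Basic facts\<close>

lemma lookup_smult [simp]: "Poly_Mapping.lookup (smult c x) b = c * Poly_Mapping.lookup x b"
  by (simp add: smult_def Poly_Mapping.map.rep_eq when_def)

lemma module_smult: "module (smult :: 'k::comm_ring_1 \<Rightarrow> ('b \<Rightarrow>\<^sub>0 'k) \<Rightarrow> _)"
  by unfold_locales (auto intro!: poly_mapping_eqI simp: lookup_add algebra_simps)

lemma lin_ext_superset:
  assumes "module s" "finite A" "Poly_Mapping.keys x \<subseteq> A"
  shows "lin_ext s f x = (\<Sum>b\<in>A. s (Poly_Mapping.lookup x b) (f b))"
proof -
  interpret module s by fact
  show ?thesis
    unfolding lin_ext_def using assms(2,3)
    by (intro sum.mono_neutral_left) (auto simp: in_keys_iff)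
qed

lemma module_hom_lin_ext:
  assumes "module s"
  shows "module_hom smult s (lin_ext s f)"
proof -
  interpret s: module s by fact
  interpret c: module "smult :: 'a \<Rightarrow> ('c \<Rightarrow>\<^sub>0 'a) \<Rightarrow> _" by (rule module_smult)
  show ?thesis
  proof unfold_locales
    fix x y :: "'c \<Rightarrow>\<^sub>0 'a"
    let ?A = "Poly_Mapping.keys x \<union> Poly_Mapping.keys y"
    have "lin_ext s f (x + y) = (\<Sum>b\<in>?A. s (Poly_Mapping.lookup (x + y) b) (f b))"
      by (rule lin_ext_superset) (use assms Poly_Mapping.keys_add[of x y] in auto)
    moreover have "lin_ext s f x = (\<Sum>b\<in>?A. s (Poly_Mapping.lookup x b) (f b))"
      by (rule lin_ext_superset) (use assms in auto)
    moreover have "lin_ext s f y = (\<Sum>b\<in>?A. s (Poly_Mapping.lookup y b) (f b))"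
      by (rule lin_ext_superset) (use assms in auto)
    ultimately show "lin_ext s f (x + y) = lin_ext s f x + lin_ext s f y"
      by (simp add: lookup_add s.scale_left_distrib sum.distrib)
  next
    fix r and x :: "'c \<Rightarrow>\<^sub>0 'a"
    have "lin_ext s f (smult r x)
        = (\<Sum>b\<in>Poly_Mapping.keys x. s (Poly_Mapping.lookup (smult r x) b) (f b))"
      by (rule lin_ext_superset) (use assms in \<open>auto simp: in_keys_iff\<close>)
    then show "lin_ext s f (smult r x) = s r (lin_ext s f x)"
      by (simp add: lin_ext_def s.scale_sum_right)
  qed
qed

lemma lin_ext_basis [simp]:
  assumes "module s"
  shows "lin_ext s f (basis b) = f b"
proof -
  interpret module s by fact
  show ?thesis by (simp add: lin_ext_def basis_def)
qed

lemma expand_basis: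
  fixes x :: "'b \<Rightarrow>\<^sub>0 'k::comm_ring_1"
  shows "x = (\<Sum>b\<in>Poly_Mapping.keys x. smult (Poly_Mapping.lookup x b) (basis b))"
  by (rule poly_mapping_eqI)
    (auto simp: lookup_sum basis_def lookup_single when_def in_keys_iff
      if_distrib[of "(*) _"] cong: if_cong)

lemma module_hom_expand:
  assumes "module_hom smult s h"
  shows "h x = lin_ext s (\<lambda>b. h (basis b)) x"
proof -
  interpret module_hom smult s h by fact
  have "h x = h (\<Sum>b\<in>Poly_Mapping.keys x. smult (Poly_Mapping.lookup x b) (basis b))"
    by (simp only: expand_basis[symmetric])
  then show ?thesis by (simp add: lin_ext_def sum scale)
qed

lemma lookup_tensor:
  "Poly_Mapping.lookup (x \<otimes> y) (b, c) = Poly_Mapping.lookup x b * Poly_Mapping.lookup y c"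
proof -
  have "Poly_Mapping.lookup (x \<otimes> y) (b, c)
     = (\<Sum>b'\<in>Poly_Mapping.keys x. if b' = b then
         (\<Sum>c'\<in>Poly_Mapping.keys y. if c' = c then
           Poly_Mapping.lookup x b' * Poly_Mapping.lookup y c' else 0) else 0)"
    unfolding tensor_def lookup_sum lookup_single when_def by (intro sum.cong) auto
  then show ?thesis
    by (auto simp: in_keys_iff)
qed

lemma tensor_basis:
  "basis b \<otimes> basis c = (basis (b, c) :: _ \<Rightarrow>\<^sub>0 'k::{comm_ring,comm_monoid_mult})"
proof (rule poly_mapping_eqI)
  fix p show "Poly_Mapping.lookup (basis b \<otimes> basis c) p
    = Poly_Mapping.lookup (basis (b, c) :: _ \<Rightarrow>\<^sub>0 'k) p"
    by (cases p) (auto simp: lookup_tensor basis_def lookup_single when_def)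
qed

lemma module_hom_tensor_left:
  "module_hom smult smult (\<lambda>x. x \<otimes> (y :: 'c \<Rightarrow>\<^sub>0 'k::comm_ring_1))"
  by (intro module_hom.intro module_hom_axioms.intro module_smult poly_mapping_eqI)
    (auto simp: lookup_tensor lookup_add algebra_simps)

lemma module_hom_tensor_right:
  "module_hom smult smult (\<lambda>y. (x :: 'b \<Rightarrow>\<^sub>0 'k::comm_ring_1) \<otimes> y)"
  by (intro module_hom.intro module_hom_axioms.intro module_smult poly_mapping_eqI)
    (auto simp: lookup_tensor lookup_add algebra_simps)

lemma bilinear_eqI:
  fixes B C :: "('b \<Rightarrow>\<^sub>0 'k::comm_ring_1) \<Rightarrow> ('c \<Rightarrow>\<^sub>0 'k) \<Rightarrow> 'm::ab_group_add"
  assumes "\<And>y. module_hom smult s (\<lambda>x. B x y)" "\<And>x. module_hom smult s (B x)"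
    and "\<And>y. module_hom smult s (\<lambda>x. C x y)" "\<And>x. module_hom smult s (C x)"
    and eq: "\<And>b c. B (basis b) (basis c) = C (basis b) (basis c)"
  shows "B x y = C x y"
proof -
  have "B (basis b) y = C (basis b) y" for b
    using module_hom_expand[OF assms(2)[of "basis b"], of y]
      module_hom_expand[OF assms(4)[of "basis b"], of y] by (simp only: eq)
  then show ?thesis
    using module_hom_expand[OF assms(1)[of y], of x]
      module_hom_expand[OF assms(3)[of y], of x] by (simp only:)
qed

lemma module_hom_comp:
  assumes "module_hom s t f" "module_hom t u g"
  shows "module_hom s u (\<lambda>x. g (f x))"
  using module_hom_compose[OF assms] by (simp add: comp_def)

lemma tensor_universal:
  fixes B :: "('b \<Rightarrow>\<^sub>0 'k::comm_ring_1) \<Rightarrow> ('c \<Rightarrow>\<^sub>0 'k) \<Rightarrow> 'm::ab_group_add"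
  assumes "module s"
    and B1: "\<And>y. module_hom smult s (\<lambda>x. B x y)" and B2: "\<And>x. module_hom smult s (B x)"
  shows "\<exists>!L. module_hom smult s L \<and> (\<forall>x y. L (x \<otimes> y) = B x y)"
proof (rule ex1I)
  define L where "L = lin_ext s (\<lambda>(b, c). B (basis b) (basis c))"
  have L: "module_hom smult s L" unfolding L_def by (rule module_hom_lin_ext) fact
  have Lb: "L (basis (b, c)) = B (basis b) (basis c)" for b c by (simp add: L_def assms(1))
  have LB: "L (x \<otimes> y) = B x y" for x y
  proof (rule bilinear_eqI[where B = "\<lambda>x y. L (x \<otimes> y)" and C = B and s = s])
    show "module_hom smult s (\<lambda>x. L (x \<otimes> y))" for y
      by (rule module_hom_comp[OF module_hom_tensor_left L])
    show "module_hom smult s (\<lambda>y. L (x \<otimes> y))" for x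
      by (rule module_hom_comp[OF module_hom_tensor_right L])
  qed (fact B1, fact B2, simp only: tensor_basis Lb)
  show "module_hom smult s L \<and> (\<forall>x y. L (x \<otimes> y) = B x y)"
    by (intro conjI allI L LB)
  fix L' assume L': "module_hom smult s L' \<and> (\<forall>x y. L' (x \<otimes> y) = B x y)"
  have "L' (basis (b, c)) = B (basis b) (basis c)" for b c
    unfolding tensor_basis[symmetric] using L' by blast
  then have eq: "(\<lambda>p. L' (basis p)) = (\<lambda>(b, c). B (basis b) (basis c))"
    by (simp add: fun_eq_iff)
  show "L' = L"
  proof
    fix x show "L' x = L x"
      unfolding L_def eq[symmetric] by (rule module_hom_expand[OF conjunct1[OF L']])
  qed
qed

lemma tensor_map_tensor:
  fixes f :: "('b \<Rightarrow>\<^sub>0 'k::comm_ring_1) \<Rightarrow> ('d \<Rightarrow>\<^sub>0 'k)"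
    and g :: "('c \<Rightarrow>\<^sub>0 'k) \<Rightarrow> ('e \<Rightarrow>\<^sub>0 'k)"
  assumes f: "module_hom smult smult f" and g: "module_hom smult smult g"
  shows "tensor_map f g (x \<otimes> y) = f x \<otimes> g y"
proof -
  have T: "module_hom smult smult (tensor_map f g)"
    unfolding tensor_map_def by (rule module_hom_lin_ext[OF module_smult])
  have Tb: "tensor_map f g (basis (b, c)) = f (basis b) \<otimes> g (basis c)" for b c
    by (simp add: tensor_map_def module_smult)
  show ?thesis
  proof (rule bilinear_eqI[where B = "\<lambda>x y. tensor_map f g (x \<otimes> y)"
        and C = "\<lambda>x y. f x \<otimes> g y" and s = smult])
    show "module_hom smult smult (\<lambda>x. tensor_map f g (x \<otimes> y))" for y
      by (rule module_hom_comp[OF module_hom_tensor_left T])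
    show "module_hom smult smult (\<lambda>y. tensor_map f g (x \<otimes> y))" for x
      by (rule module_hom_comp[OF module_hom_tensor_right T])
    show "module_hom smult smult (\<lambda>x. f x \<otimes> g y)" for y
      by (rule module_hom_comp[OF f module_hom_tensor_left])
    show "module_hom smult smult (\<lambda>y. f x \<otimes> g y)" for x
      by (rule module_hom_comp[OF g module_hom_tensor_right])
  qed (simp only: tensor_basis Tb)
qed

lemma internal_vertices_combs:
  "internal_vertices (right_comb n) = n" "internal_vertices (left_comb n) = n"
  by (induction n) auto

end

theory Submission
  imports Defs
begin

text \<open>
  A comb has a trivial tree as one branch of its root, and \<open>\<Delta>(|) = 0\<close>. So for a comb one of the two
  recursive terms of the coproduct vanishes, and what remains is
  \<open>\<Delta>(F \<or> |) = F \<otimes> | + (id \<otimes> \<or>)(\<Delta>(F) \<otimes> |)\<close> for right combs, and its mirror image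
  \<open>\<Delta>(| \<or> F) = | \<otimes> F + (\<or> \<otimes> id)(| \<otimes> \<Delta>(F))\<close> for left combs. In the induction on the number of
  internal vertices, \<open>\<Delta>(F)\<close> is a sum of tensors of basis trees. Grafting turns a right comb \<open>F\<^sub>i\<close> in
  its right factor (for left combs: left factor) into \<open>F\<^bsub>i+1\<^esub>\<close>, so the recursive term is the sum for
  \<open>n + 1\<close> without its term of index \<open>0\<close>; that missing term is the non-recursive one. How the grafting
  terms act on such sums is \<open>graft_right_sum\<close> and \<open>graft_left_sum\<close>.

  Over the zero ring \<open>1 = 0\<close> and every basis vector vanishes, so the theory of modules over a
  ring with \<open>0 \<noteq> 1\<close> does not apply directly. The additivity of \<open>lin_ext\<close> and of \<open>\<otimes>\<close> is therefore
  derived coefficientwise, which uses the ring operations of \<open>'k\<close> only.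
\<close>

lemma lookup_lin_ext_superset:
  fixes f :: "'b \<Rightarrow> ('c \<Rightarrow>\<^sub>0 'k::{comm_ring,comm_monoid_mult})"
  assumes "finite A" "Poly_Mapping.keys x \<subseteq> A"
  shows "Poly_Mapping.lookup (lin_ext smult f x) c
           = (\<Sum>b\<in>A. Poly_Mapping.lookup x b * Poly_Mapping.lookup (f b) c)"
  unfolding lin_ext_def lookup_sum lookup_smult using assms
  by (intro sum.mono_neutral_left) (auto simp: in_keys_iff)

lemma lin_ext_smult_zero:
  "lin_ext smult f 0 = (0 :: 'c \<Rightarrow>\<^sub>0 'k::{comm_ring,comm_monoid_mult})"
  by (simp add: lin_ext_def)

lemma lin_ext_smult_add:
  fixes f :: "'b \<Rightarrow> ('c \<Rightarrow>\<^sub>0 'k::{comm_ring,comm_monoid_mult})"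
  shows "lin_ext smult f (x + y) = lin_ext smult f x + lin_ext smult f y"
proof (rule poly_mapping_eqI)
  fix c
  let ?A = "Poly_Mapping.keys x \<union> Poly_Mapping.keys y"
  have "Poly_Mapping.keys (x + y) \<subseteq> ?A" by (rule Poly_Mapping.keys_add)
  then show "Poly_Mapping.lookup (lin_ext smult f (x + y)) c
      = Poly_Mapping.lookup (lin_ext smult f x + lin_ext smult f y) c"
    by (simp add: lookup_lin_ext_superset[where A = ?A] lookup_add distrib_right sum.distrib)
qed

lemma lin_ext_smult_sum:
  fixes f :: "'b \<Rightarrow> ('c \<Rightarrow>\<^sub>0 'k::{comm_ring,comm_monoid_mult})"
  shows "lin_ext smult f (\<Sum>i\<in>I. x i) = (\<Sum>i\<in>I. lin_ext smult f (x i))"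
  by (induction I rule: infinite_finite_induct) (simp_all add: lin_ext_smult_zero lin_ext_smult_add)

text \<open>
  In the zero ring \<open>basis b\<close> has no keys. The sum is therefore taken over the superset \<open>{b}\<close> of its
  keys, which treats both cases alike.
\<close>

lemma lin_ext_smult_basis:
  fixes f :: "'b \<Rightarrow> ('c \<Rightarrow>\<^sub>0 'k::{comm_ring,comm_monoid_mult})"
  shows "lin_ext smult f (basis b) = f b"
proof (rule poly_mapping_eqI)
  fix c
  have "Poly_Mapping.keys (basis b :: _ \<Rightarrow>\<^sub>0 'k) \<subseteq> {b}"
    by (auto simp: basis_def in_keys_iff lookup_single when_def split: if_splits)
  then show "Poly_Mapping.lookup (lin_ext smult f (basis b)) c = Poly_Mapping.lookup (f b) c"
    by (simp add: lookup_lin_ext_superset[where A = "{b}"] basis_def)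
qed

lemma tensor_zero:
  "x \<otimes> (0 :: 'c \<Rightarrow>\<^sub>0 'k::{comm_ring,comm_monoid_mult}) = 0"
  "(0 :: 'b \<Rightarrow>\<^sub>0 'k) \<otimes> y = 0"
  by (simp_all add: tensor_def)

lemma tensor_map_zero: "tensor_map f g 0 = 0"
  by (simp add: tensor_map_def lin_ext_smult_zero)

lemma assoc_zero: "assoc_r 0 = 0" "assoc_l 0 = 0"
  by (simp_all add: assoc_r_def assoc_l_def lin_ext_smult_zero)

lemma tensor_sum_left:
  fixes y :: "'c \<Rightarrow>\<^sub>0 'k::{comm_ring,comm_monoid_mult}"
  shows "(\<Sum>i\<in>I. x i) \<otimes> y = (\<Sum>i\<in>I. x i \<otimes> y)"
  by (rule poly_mapping_eqI)
    (auto simp: lookup_sum lookup_tensor sum_distrib_right)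

lemma tensor_sum_right:
  fixes x :: "'b \<Rightarrow>\<^sub>0 'k::{comm_ring,comm_monoid_mult}"
  shows "x \<otimes> (\<Sum>i\<in>I. y i) = (\<Sum>i\<in>I. x \<otimes> y i)"
  by (rule poly_mapping_eqI)
    (auto simp: lookup_sum lookup_tensor sum_distrib_left)

text \<open>
  These are the two recursive terms of the coproduct, evaluated on a branch whose coproduct is
  known as a sum of tensors of trees. The map is additive in that branch, and on basis vectors
  reassociation is only a regrouping of indices.
\<close>

lemma graft_right_sum:
  "tensor_map id graft (assoc_r ((\<Sum>i\<in>I. basis (l i) \<otimes> basis (m i)) \<otimes> basis r))
     = (\<Sum>i\<in>I. basis (l i) \<otimes> (basis (Graft (m i) r)
          :: pbtree \<Rightarrow>\<^sub>0 'k::{comm_ring,comm_monoid_mult}))"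
  by (simp add: tensor_map_def assoc_r_def graft_def tensor_sum_left tensor_basis
      lin_ext_smult_sum lin_ext_smult_basis)

lemma graft_left_sum:
  "tensor_map graft id (assoc_l (basis l \<otimes> (\<Sum>i\<in>I. basis (m i) \<otimes> basis (r i))))
     = (\<Sum>i\<in>I. (basis (Graft l (m i))
          :: pbtree \<Rightarrow>\<^sub>0 'k::{comm_ring,comm_monoid_mult}) \<otimes> basis (r i))"
  by (simp add: tensor_map_def assoc_l_def graft_def tensor_sum_right tensor_basis
      lin_ext_smult_sum lin_ext_smult_basis)

lemma coproduct_tree_Graft_Triv:
  assumes "coproduct_tree t = (\<Sum>i\<in>I. basis (l i) \<otimes> basis (r i)
    :: _ \<Rightarrow>\<^sub>0 'k::{comm_ring,comm_monoid_mult})"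
  shows "coproduct_tree (Graft t Triv) = basis t \<otimes> basis Triv
    + (\<Sum>i\<in>I. basis (l i) \<otimes> basis (Graft (r i) Triv) :: _ \<Rightarrow>\<^sub>0 'k)"
  by (simp add: assms graft_right_sum tensor_zero assoc_zero tensor_map_zero)

lemma coproduct_tree_Triv_Graft:
  assumes "coproduct_tree t = (\<Sum>i\<in>I. basis (l i) \<otimes> basis (r i)
    :: _ \<Rightarrow>\<^sub>0 'k::{comm_ring,comm_monoid_mult})"
  shows "coproduct_tree (Graft Triv t) = basis Triv \<otimes> basis t
    + (\<Sum>i\<in>I. basis (Graft Triv (l i)) \<otimes> basis (r i) :: _ \<Rightarrow>\<^sub>0 'k)"
  by (simp add: assms graft_left_sum tensor_zero assoc_zero tensor_map_zero)

lemma coproduct_tree_right_comb: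
  "(coproduct_tree (right_comb n) :: _ \<Rightarrow>\<^sub>0 'k::{comm_ring,comm_monoid_mult})
     = (\<Sum>i<n. basis (right_comb (n - 1 - i)) \<otimes> basis (right_comb i))"
proof (induction n)
  case (Suc n)
  from coproduct_tree_Graft_Triv[OF Suc.IH] show ?case
    by (simp add: sum.lessThan_Suc_shift del: sum.lessThan_Suc coproduct_tree.simps)
qed simp

lemma coproduct_tree_left_comb:
  "(coproduct_tree (left_comb n) :: _ \<Rightarrow>\<^sub>0 'k::{comm_ring,comm_monoid_mult})
     = (\<Sum>i<n. basis (left_comb i) \<otimes> basis (left_comb (n - 1 - i)))"
proof (induction n)
  case (Suc n)
  from coproduct_tree_Triv_Graft[OF Suc.IH] show ?case
    by (simp add: sum.lessThan_Suc_shift del: sum.lessThan_Suc coproduct_tree.simps)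
qed simp

theorem corollary3p4:
  fixes n :: nat
  shows "(coproduct (basis (right_comb n)) :: pbtree \<times> pbtree \<Rightarrow>\<^sub>0 'k::{comm_ring,comm_monoid_mult})
           = (\<Sum>i<n. basis (right_comb (n - 1 - i)) \<otimes> basis (right_comb i))
       \<and> (coproduct (basis (left_comb n)) :: pbtree \<times> pbtree \<Rightarrow>\<^sub>0 'k)
           = (\<Sum>i<n. basis (left_comb i) \<otimes> basis (left_comb (n - 1 - i)))"
  unfolding coproduct_def lin_ext_smult_basis
  by (intro conjI coproduct_tree_right_comb coproduct_tree_left_comb)

end
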